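(* Let the model be as in the context, and assume $$\int_{\mathrm{supp}(Y)}\frac{\mathbb E[G\,p(y|G)]^2}{\mathbb E[p(y|G)]}\,dy\in(0,\infty),$$ where the expectations are with respect to $G\sim\mathcal N(0,1)$. Write $\alpha_1=\alpha$ and $\alpha_2=1-\alpha$. Then, for any $\delta\in(0,\infty)$ and $i\in\{1,2\}$, $$\mathsf{OL}_i^{\mathrm{lin}}=\left(\frac{\alpha_1^2+\alpha_2^2}{\alpha_i^2}+\frac1{\alpha_i^2\delta}\cdot\frac1{\int_{\mathrm{supp}(Y)}\frac{\mathbb E[Gp(y|G)]^2}{\mathbb E[p(y|G)]}\,dy}\right)^{-1/2}.$$ Moreover, define $\mathcal L^*:\mathbb R\to\mathbb R$ by $$\mathcal L^*(y)=\frac{\mathbb E[G\,p(y|G)]}{\mathbb E[p(y|G)]}.$$ Then $\mathcal L^*\in\mathcal I$, and for any $\delta\in(0,\infty)$ both $\mathsf{OL}_1^{\mathrm{lin}}$ and $\mathsf{OL}_2^{\mathrm{lin}}$ are simultaneously achieved by $\mathcal L^*$.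
   Context: Model. For each dimension $d$ let $n=n(d)$, with $n,d\to\infty$ and $n/d\to\delta\in(0,\infty)$. Let $q:\mathbb R^2\to\mathbb R$ be a known link function, $P_\varepsilon$ a distribution on $\mathbb R$ with finite second moment, and $\alpha\in(1/2,1)$. The signals $x_1^*,x_2^*$ are independent and uniform on the unit sphere $\mathbb S^{d-1}$; the covariates $a_1,\dots,a_n$ are i.i.d. $\mathcal N(0,I_d)$; the latent variables $\eta_1,\dots,\eta_n$ are i.i.d. Bernoulli$(\alpha)$; the noise variables $\varepsilon_1,\dots,\varepsilon_n$ are i.i.d. $P_\varepsilon$; all of these are mutually independent. The observations are $y_i=q(\langle a_i,\eta_ix_1^*+(1-\eta_i)x_2^*\rangle,\varepsilon_i)$, $i=1,\dots,n$. Let $(G,\varepsilon)\sim\mathcal N(0,1)\otimes P_\varepsilon$ and $Y=q(G,\varepsilon)$; $\mathrm{supp}(Y)$ is the support of the density of $Y$. For fixed $g\in\mathbb R$, $p(\cdot|g)$ denotes the distribution of $q(g,\varepsilon)$, $\varepsilon\sim P_\varepsilon$, written as a density in $y$ (so $\mathbb E[G^kp(y|G)]$ is the density at $y$ of the measure $B\mapsto\mathbb E[G^k\mathbf 1\{Y\in B\}]$). Linear estimators and optimal overlaps. For $\mathcal L:\mathbb R\to\mathbb R$, the linear estimator is $\frac1n\sum_i\mathcal L(y_i)a_i$. Let $$\mathcal I=\{\mathcal L:\mathbb R\to\mathbb R\ \text{Lipschitz}:\ \mathbb E[G\mathcal L(Y)]\ne0,\ \mathbb E|G\mathcal L(Y)|<\infty\}.$$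 For $\mathcal L\in\mathcal I$ and $i\in\{1,2\}$ let $$\rho_i^{\mathrm{lin}}=\frac{\alpha_i\,\mathbb E[G\mathcal L(Y)]}{\big((\alpha_1^2+\alpha_2^2)\,\mathbb E[G\mathcal L(Y)]^2+\mathbb E[\mathcal L(Y)^2]/\delta\big)^{1/2}},\qquad \alpha_1=\alpha,\ \alpha_2=1-\alpha$$ (the asymptotic overlap of the linear estimator with $x_i^*$), and $\mathsf{OL}_i^{\mathrm{lin}}=\sup_{\mathcal L\in\mathcal I}\rho_i^{\mathrm{lin}}$ (set to $0$ if $\mathcal I=\emptyset$). "Achieved by $\mathcal L^*$" means that $\rho_i^{\mathrm{lin}}$ evaluated at $\mathcal L=\mathcal L^*$ equals $\mathsf{OL}_i^{\mathrm{lin}}$.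
   Formalization: L* ∈ I is claimed only when L*, or a version equal to it a.e. on supp(Y), is Lipschitz: for q(g,e)=(g+e)^3 with N(0,1) noise, L*(y) is half the cube root of y, not Lipschitz; the formula, the other conditions of I and attainment by L* are unconditional. *)

theory Defs
  imports "HOL-Probability.Probability"
begin

text \<open>
  The overlaps of linear estimators depend on the model only through the law of
  \<open>(G, \<epsilon>)\<close>, the link function \<open>q\<close>, the mixing probability \<open>\<alpha>\<close> and the
  aspect ratio \<open>\<delta>\<close>. Throughout, \<open>P\<close> is the law of the noise and \<open>Y = q G \<epsilon>\<close>.
\<close>

definition std_gauss :: "real measure" where
  "std_gauss = density lborel (\<lambda>g. ennreal (std_normal_density g))"

definition joint_law :: "real measure \<Rightarrow> (real \<times> real) measure" where
  "joint_law P = std_gauss \<Otimes>\<^sub>M P"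

text \<open>
  \<open>moment_density P q k f\<close>: the function \<open>f\<close> is a version of \<open>y \<mapsto> E[G\<^sup>k p(y|G)]\<close>, i.e. a
  Lebesgue density of the finite signed measure \<open>B \<mapsto> E[G\<^sup>k 1{Y \<in> B}]\<close>. The laws
  \<open>p(\<cdot>|g)\<close> need not be absolutely continuous themselves (noiseless link functions are
  allowed); if they are, the pointwise integral is such a version, see
  \<open>moment_density_conditional\<close> below. Only versions up to Lebesgue null sets are determined.
\<close>
definition moment_density ::
  "real measure \<Rightarrow> (real \<Rightarrow> real \<Rightarrow> real) \<Rightarrow> nat \<Rightarrow> (real \<Rightarrow> real) \<Rightarrow> bool" where
  "moment_density P q k f \<longleftrightarrow> f \<in> borel_measurable borel \<and> integrable lborel f \<and>
     (\<forall>B\<in>sets borel. (LINT y:B|lborel. f y) =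
        (LINT (g, e)|joint_law P. g ^ k * indicator B (q g e)))"

definition dens_supp :: "(real \<Rightarrow> real) \<Rightarrow> real set" where
  "dens_supp f0 = {y. f0 y \<noteq> 0}"

text \<open>Off \<open>dens_supp f0\<close> the quotient is \<open>0\<close> by the convention \<open>x / 0 = 0\<close>.
  The quotient \<open>E[G | Y = y]\<close> need not have a Lipschitz version: for \<open>q g e = (g + e)^3\<close>
  with standard normal noise it is \<open>y powr (1/3) / 2\<close> for \<open>y > 0\<close>.\<close>
definition L_star :: "(real \<Rightarrow> real) \<Rightarrow> (real \<Rightarrow> real) \<Rightarrow> real \<Rightarrow> real" where
  "L_star f0 f1 y = f1 y / f0 y"

definition lipschitz_fun :: "(real \<Rightarrow> real) \<Rightarrow> bool" where
  "lipschitz_fun L \<longleftrightarrow> (\<exists>C. C-lipschitz_on UNIV L)"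

definition mean_GL :: "real measure \<Rightarrow> (real \<Rightarrow> real \<Rightarrow> real) \<Rightarrow> (real \<Rightarrow> real) \<Rightarrow> real" where
  "mean_GL P q L = (LINT (g, e)|joint_law P. g * L (q g e))"

definition GL_integrable :: "real measure \<Rightarrow> (real \<Rightarrow> real \<Rightarrow> real) \<Rightarrow> (real \<Rightarrow> real) \<Rightarrow> bool" where
  "GL_integrable P q L \<longleftrightarrow> integrable (joint_law P) (\<lambda>(g, e). g * L (q g e))"

definition lin_class :: "real measure \<Rightarrow> (real \<Rightarrow> real \<Rightarrow> real) \<Rightarrow> (real \<Rightarrow> real) set" where
  "lin_class P q = {L. lipschitz_fun L \<and> mean_GL P q L \<noteq> 0 \<and> GL_integrable P q L}"

definition second_moment_L ::
  "real measure \<Rightarrow> (real \<Rightarrow> real \<Rightarrow> real) \<Rightarrow> (real \<Rightarrow> real) \<Rightarrow> ennreal" where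
  "second_moment_L P q L = (\<integral>\<^sup>+ (g, e). ennreal ((L (q g e))\<^sup>2) \<partial>joint_law P)"

definition mix_weight :: "real \<Rightarrow> nat \<Rightarrow> real" where
  "mix_weight \<alpha> i = (if i = 1 then \<alpha> else 1 - \<alpha>)"

text \<open>
  Membership in \<open>lin_class\<close> does not force \<open>E[L(Y)\<^sup>2] < \<infinity>\<close>. When this moment is infinite so
  is the denominator, and the overlap is \<open>0\<close> (whereas a real-valued integral would
  wrongly drop the term \<open>E[L(Y)\<^sup>2] / \<delta>\<close>).
\<close>
definition rho_lin ::
  "real measure \<Rightarrow> (real \<Rightarrow> real \<Rightarrow> real) \<Rightarrow> real \<Rightarrow> real \<Rightarrow> nat \<Rightarrow> (real \<Rightarrow> real) \<Rightarrow> real" where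
  "rho_lin P q \<alpha> \<delta> i L =
     (if second_moment_L P q L = \<infinity> then 0
      else mix_weight \<alpha> i * mean_GL P q L /
        sqrt (((mix_weight \<alpha> 1)\<^sup>2 + (mix_weight \<alpha> 2)\<^sup>2) * (mean_GL P q L)\<^sup>2
              + enn2real (second_moment_L P q L) / \<delta>))"

text \<open>
  The real-valued supremum is meaningful: on \<open>lin_class\<close> the overlaps are bounded in absolute
  value by \<open>\<alpha>\<^sub>i / sqrt (\<alpha>\<^sub>1\<^sup>2 + \<alpha>\<^sub>2\<^sup>2)\<close>.
\<close>
definition OL_lin ::
  "real measure \<Rightarrow> (real \<Rightarrow> real \<Rightarrow> real) \<Rightarrow> real \<Rightarrow> real \<Rightarrow> nat \<Rightarrow> real" where
  "OL_lin P q \<alpha> \<delta> i =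
     (if lin_class P q = {} then 0 else (SUP L\<in>lin_class P q. rho_lin P q \<alpha> \<delta> i L))"

lemma prob_space_std_gauss: "prob_space std_gauss"
  unfolding std_gauss_def by (rule prob_space_normal_density) simp

lemma sets_std_gauss [measurable_cong]: "sets std_gauss = sets borel"
  unfolding std_gauss_def by simp

lemma integrable_std_gauss_power: "integrable std_gauss (\<lambda>g. g ^ k)"
proof -
  have "integrable lborel (\<lambda>g::real. std_normal_density g * g ^ k)"
    by (rule integrable_std_normal_moment)
  then show ?thesis
    unfolding std_gauss_def by (subst integrable_density) auto
qed

lemma moment_density_conditional:
  fixes p q :: "real \<Rightarrow> real \<Rightarrow> real"
  assumes P: "prob_space P" "sets P = sets borel"
    and q [measurable]: "(\<lambda>(g, e). q g e) \<in> borel_measurable borel"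
    and p [measurable]: "(\<lambda>(g, y). p g y) \<in> borel_measurable borel"
    and p_nonneg: "\<And>g y. p g y \<ge> 0"
    and p_dens: "\<And>g. distr P borel (q g) = density lborel (\<lambda>y. ennreal (p g y))"
  shows "moment_density P q k (\<lambda>y. LINT g|std_gauss. g ^ k * p g y)"
proof -
  interpret P: prob_space P by fact
  interpret N: prob_space std_gauss by (rule prob_space_std_gauss)
  interpret NP: pair_prob_space std_gauss P ..
  interpret NL: pair_sigma_finite std_gauss lborel ..
  note [measurable_cong] = P(2)
  have pm [measurable]: "(\<lambda>x. p (fst x) (snd x)) \<in> borel_measurable (borel \<Otimes>\<^sub>M borel)"
    using p by (simp add: borel_prod case_prod_beta')
  have qm [measurable]: "(\<lambda>x. q (fst x) (snd x)) \<in> borel_measurable (borel \<Otimes>\<^sub>M borel)"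
    using q by (simp add: borel_prod case_prod_beta')
  have pg [measurable]: "p g \<in> borel_measurable borel" for g
    using measurable_compose[OF measurable_Pair1'[of g borel borel] pm] by simp
  have qg [measurable]: "q g \<in> borel_measurable borel" for g
    using measurable_compose[OF measurable_Pair1'[of g borel borel] qm] by simp
  have emeas: "emeasure P {e \<in> space P. q g e \<in> B} = (\<integral>\<^sup>+y. ennreal (p g y * indicator B y) \<partial>lborel)"
    if [measurable]: "B \<in> sets borel" for g B
  proof -
    have "emeasure P {e \<in> space P. q g e \<in> B} = emeasure (distr P borel (q g)) B"
      by (subst emeasure_distr) (auto simp: vimage_def Int_def conj_commute)
    also have "\<dots> = (\<integral>\<^sup>+y. ennreal (p g y) * indicator B y \<partial>lborel)"
      unfolding p_dens by (rule emeasure_density) auto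
    also have "\<dots> = (\<integral>\<^sup>+y. ennreal (p g y * indicator B y) \<partial>lborel)"
      by (intro nn_integral_cong) (auto simp: indicator_def)
    finally show ?thesis .
  qed
  have lint: "(LINT y|lborel. p g y * indicator B y) = measure P {e \<in> space P. q g e \<in> B}"
    and int: "integrable lborel (\<lambda>y. p g y * indicator B y)"
    if [measurable]: "B \<in> sets borel" for g B
  proof -
    show *: "integrable lborel (\<lambda>y. p g y * indicator B y)"
      by (rule integrableI_nonneg) (use p_nonneg in \<open>auto simp: emeas[symmetric] P.emeasure_eq_measure\<close>)
    show "(LINT y|lborel. p g y * indicator B y) = measure P {e \<in> space P. q g e \<in> B}"
      using p_nonneg
      by (subst integral_eq_nn_integral) (auto simp: emeas[symmetric] P.emeasure_eq_measure)
  qed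
  have int_pair: "integrable (std_gauss \<Otimes>\<^sub>M lborel) (\<lambda>(g, y). g ^ k * (p g y * indicator B y))"
    if [measurable]: "B \<in> sets borel" for B
  proof (rule NL.Fubini_integrable)
    show "integrable std_gauss (\<lambda>g. LINT y|lborel. norm (case (g, y) of (g, y) \<Rightarrow> g ^ k * (p g y * indicator B y)))"
    proof (rule Bochner_Integration.integrable_bound[OF integrable_std_gauss_power[of k]])
      show "AE g in std_gauss. norm (LINT y|lborel. norm (case (g, y) of (g, y) \<Rightarrow> g ^ k * (p g y * indicator B y)))
              \<le> norm (g ^ k)"
      proof (rule AE_I2)
        fix g
        have "(LINT y|lborel. norm (g ^ k * (p g y * indicator B y)))
             = \<bar>g ^ k\<bar> * measure P {e \<in> space P. q g e \<in> B}"
          using p_nonneg by (simp add: abs_mult lint that)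
        then show "norm (LINT y|lborel. norm (case (g, y) of (g, y) \<Rightarrow> g ^ k * (p g y * indicator B y)))
              \<le> norm (g ^ k)"
          by (simp add: abs_mult p_nonneg lint[OF that] mult_left_le)
      qed
    qed measurable
    show "AE g in std_gauss. integrable lborel (\<lambda>y. case (g, y) of (g, y) \<Rightarrow> g ^ k * (p g y * indicator B y))"
      using int[OF that] by auto
  qed measurable
  have main: "(LINT y:B|lborel. (LINT g|std_gauss. g ^ k * p g y)) =
        (LINT (g, e)|joint_law P. g ^ k * indicator B (q g e))" if B [measurable]: "B \<in> sets borel" for B
  proof -
    have intNP: "integrable (std_gauss \<Otimes>\<^sub>M P) (\<lambda>(g, e). g ^ k * indicator B (q g e))"
    proof (rule NP.Fubini_integrable)
      show "integrable std_gauss (\<lambda>g. LINT e|P. norm (case (g, e) of (g, e) \<Rightarrow> g ^ k * indicator B (q g e)))"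
      proof (rule Bochner_Integration.integrable_bound[OF integrable_std_gauss_power[of k]])
        show "AE g in std_gauss. norm (LINT e|P. norm (case (g, e) of (g, e) \<Rightarrow> g ^ k * indicator B (q g e)))
              \<le> norm (g ^ k)"
        proof (rule AE_I2)
          fix g
          have "(LINT e|P. \<bar>indicator B (q g e) :: real\<bar>) \<le> 1"
            by (rule P.integral_le_const)
               (auto intro!: P.integrable_const_bound[of _ 1] simp: indicator_def)
          then show "norm (LINT e|P. norm (case (g, e) of (g, e) \<Rightarrow> g ^ k * indicator B (q g e)))
              \<le> norm (g ^ k)"
            by (simp add: abs_mult mult_left_le)
        qed
      qed measurable
      show "AE g in std_gauss. integrable P (\<lambda>e. case (g, e) of (g, e) \<Rightarrow> g ^ k * indicator B (q g e))"
        by (auto intro!: P.integrable_const_bound[of _ 1] simp: indicator_def)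
    qed measurable
    have ind: "(LINT e|P. indicator B (q g e) :: real) = measure P {e \<in> space P. q g e \<in> B}" for g
    proof -
      have "(LINT e|P. indicator B (q g e) :: real) = (LINT e|P. indicator {e \<in> space P. q g e \<in> B} e)"
        by (intro Bochner_Integration.integral_cong) (auto simp: indicator_def)
      then show ?thesis by simp
    qed
    have "(LINT y:B|lborel. (LINT g|std_gauss. g ^ k * p g y))
        = (LINT y|lborel. (LINT g|std_gauss. g ^ k * (p g y * indicator B y)))"
      unfolding set_lebesgue_integral_def
      by (intro Bochner_Integration.integral_cong) (auto simp: indicator_def)
    also have "\<dots> = (LINT g|std_gauss. (LINT y|lborel. g ^ k * (p g y * indicator B y)))"
      using NL.Fubini_integral[OF int_pair[OF B]] by simp
    also have "\<dots> = (LINT g|std_gauss. g ^ k * measure P {e \<in> space P. q g e \<in> B})"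
      by (simp add: lint)
    also have "\<dots> = (LINT g|std_gauss. (LINT e|P. g ^ k * indicator B (q g e)))"
      by (simp add: ind)
    also have "\<dots> = (LINT (g, e)|joint_law P. g ^ k * indicator B (q g e))"
      unfolding joint_law_def using NP.integral_fst'[OF intNP] by simp
    finally show ?thesis .
  qed
  have "integrable lborel (\<lambda>y. LINT g|std_gauss. g ^ k * p g y)"
    using NL.integrable_snd[of "\<lambda>g y. g ^ k * (p g y * indicator UNIV y)"] int_pair[of UNIV]
    by simp
  then show ?thesis
    unfolding moment_density_def using main by (auto dest: borel_measurable_integrable)
qed

end

theory Submission
  imports Defs
begin

text \<open>
  Write \<open>m(y) = E[G | Y = y]\<close> for the function \<open>L_star f0 f1\<close> and \<open>I = E[m(Y)\<^sup>2]\<close>, which is the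
  integral in the statement. The overlap of a linear estimator depends on its preprocessing \<open>L\<close>
  only through \<open>E[G L(Y)]\<close> and \<open>E[L(Y)\<^sup>2]\<close>; for \<open>E[G L(Y)] > 0\<close> it is a decreasing function of the
  ratio \<open>E[L(Y)\<^sup>2] / E[G L(Y)]\<^sup>2\<close>. Conditioning on \<open>Y\<close> gives \<open>E[G L(Y)] = E[m(Y) L(Y)]\<close>, so by the
  Cauchy-Schwarz inequality that ratio is at least \<open>1 / I\<close>, with equality at \<open>L = m\<close>. This bounds
  every overlap by the claimed value (\<open>overlap_le_self\<close>), and since neither the weight of the
  signal nor \<open>\<delta>\<close> enters the ratio, one and the same function is optimal for both signals and all
  aspect ratios.

  It remains to see that the bound is the supremum over Lipschitz functions, although \<open>m\<close> may
  fail to be Lipschitz. Lipschitz functions are dense in \<open>L\<^sup>2\<close> of the law of \<open>Y\<close>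
  (\<open>lipschitz_dense_L2\<close>), and both moments are continuous in \<open>L\<^sup>2\<close>, so the overlaps of a sequence of
  Lipschitz functions converging to \<open>m\<close> converge to the overlap of \<open>m\<close> (\<open>lipschitz_sequence\<close>).

  The identification of \<open>m(Y)\<close> with \<open>E[G | Y]\<close> comes from the moment densities
  (\<open>conditional_mean_joint_law\<close>): the law of \<open>Y\<close> has density \<open>f0\<close>, and \<open>f1 = f0 m\<close> almost everywhere
  because \<open>f1\<close> cannot carry mass where \<open>f0\<close> vanishes.
\<close>

section \<open>The overlap as a function of two moments\<close>

text \<open>
  Here \<open>m\<close> stands for \<open>E[G L(Y)]\<close>, \<open>s\<close> for \<open>E[L(Y)\<^sup>2]\<close>, \<open>a\<close> for the weight of the signal and \<open>c\<close> for
  the sum of the squared weights.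
\<close>
definition overlap :: "real \<Rightarrow> real \<Rightarrow> real \<Rightarrow> real \<Rightarrow> real \<Rightarrow> real" where
  "overlap a c \<delta> m s = a * m / sqrt (c * m\<^sup>2 + s / \<delta>)"

lemma overlap_self:
  assumes "c > 0" "\<delta> > 0" "I > 0"
  shows "overlap a c \<delta> I I = a / sqrt (c + 1 / (\<delta> * I))"
proof -
  have "c * I\<^sup>2 + I / \<delta> = I\<^sup>2 * (c + 1 / (\<delta> * I))"
    using assms by (simp add: field_simps power2_eq_square)
  then have "sqrt (c * I\<^sup>2 + I / \<delta>) = I * sqrt (c + 1 / (\<delta> * I))"
    using assms by (simp add: real_sqrt_mult)
  then show ?thesis
    using assms by (simp add: overlap_def)
qed

text \<open>
  Dividing numerator and denominator by \<open>\<bar>m\<bar>\<close> leaves a quantity that is monotone in \<open>s / m\<^sup>2\<close>, and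
  \<open>s / m\<^sup>2 \<ge> 1 / I\<close> with equality at \<open>m = s = I\<close>. A negative \<open>m\<close> only makes the overlap negative.
\<close>
lemma overlap_le_self:
  assumes "a > 0" "c > 0" "\<delta> > 0" "I > 0" and m: "m \<noteq> 0" "m\<^sup>2 \<le> s * I"
  shows "overlap a c \<delta> m s \<le> overlap a c \<delta> I I"
proof -
  have "m\<^sup>2 * (c + 1 / (\<delta> * I)) \<le> c * m\<^sup>2 + s / \<delta>"
    using assms by (simp add: field_simps)
  then have "\<bar>m\<bar> * sqrt (c + 1 / (\<delta> * I)) \<le> sqrt (c * m\<^sup>2 + s / \<delta>)"
    by (metis real_sqrt_abs real_sqrt_le_iff real_sqrt_mult)
  moreover have "\<bar>m\<bar> * sqrt (c + 1 / (\<delta> * I)) > 0"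
    using assms by (simp add: add_pos_pos)
  moreover from calculation have "sqrt (c * m\<^sup>2 + s / \<delta>) > 0" by linarith
  ultimately have "a * \<bar>m\<bar> / sqrt (c * m\<^sup>2 + s / \<delta>) \<le> a * \<bar>m\<bar> / (\<bar>m\<bar> * sqrt (c + 1 / (\<delta> * I)))"
    using assms by (intro divide_left_mono) (auto intro!: mult_nonneg_nonneg simp: zero_less_mult_iff)
  also have "\<dots> = overlap a c \<delta> I I"
    using assms by (simp add: overlap_self)
  finally have "a * \<bar>m\<bar> / sqrt (c * m\<^sup>2 + s / \<delta>) \<le> overlap a c \<delta> I I" .
  moreover have "overlap a c \<delta> m s \<le> a * \<bar>m\<bar> / sqrt (c * m\<^sup>2 + s / \<delta>)"
    unfolding overlap_def
  proof (rule divide_right_mono)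
    have "0 \<le> m\<^sup>2" by simp
    then have "s \<ge> 0" using m(2) \<open>I > 0\<close> by (metis order_trans zero_le_mult_iff not_less)
    then show "0 \<le> sqrt (c * m\<^sup>2 + s / \<delta>)" using assms by auto
  qed (use assms in auto)
  ultimately show ?thesis by linarith
qed

lemma overlap_self_powr:
  assumes "a > 0" "c > 0" "\<delta> > 0" "I > 0"
  shows "overlap a c \<delta> I I = (c / a\<^sup>2 + 1 / (a\<^sup>2 * \<delta>) * (1 / I)) powr (-1/2)"
proof -
  have pos: "c + 1 / (\<delta> * I) > 0" using assms by (simp add: add_pos_pos)
  have "c / a\<^sup>2 + 1 / (a\<^sup>2 * \<delta>) * (1 / I) = (c + 1 / (\<delta> * I)) / a\<^sup>2"
    using assms by (simp add: field_simps)
  moreover have "\<dots> powr (-1/2) = 1 / sqrt ((c + 1 / (\<delta> * I)) / a\<^sup>2)"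
    using pos assms by (simp add: powr_minus_divide powr_half_sqrt)
  moreover have "\<dots> = a / sqrt (c + 1 / (\<delta> * I))"
    using assms by (simp add: real_sqrt_divide)
  ultimately show ?thesis using assms by (simp add: overlap_self)
qed

lemma tendsto_overlap:
  assumes "c > 0" "\<delta> > 0" "I > 0" "m \<longlonglongrightarrow> I" "s \<longlonglongrightarrow> I"
  shows "(\<lambda>n. overlap a c \<delta> (m n) (s n)) \<longlonglongrightarrow> overlap a c \<delta> I I"
proof -
  have "c * I\<^sup>2 + I / \<delta> > 0" using assms by (simp add: add_pos_pos)
  then show ?thesis unfolding overlap_def
    using assms by (intro tendsto_intros) auto
qed

section \<open>Square-integrable functions\<close>

lemma integrable_mult_L2:
  fixes f g :: "'a \<Rightarrow> real"
  assumes [measurable]: "f \<in> borel_measurable M" "g \<in> borel_measurable M"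
    and "integrable M (\<lambda>x. (f x)\<^sup>2)" "integrable M (\<lambda>x. (g x)\<^sup>2)"
  shows "integrable M (\<lambda>x. f x * g x)"
proof (rule Bochner_Integration.integrable_bound)
  show "integrable M (\<lambda>x. (f x)\<^sup>2 + (g x)\<^sup>2)" using assms by simp
  have "\<bar>a * b\<bar> \<le> a\<^sup>2 + b\<^sup>2" for a b :: real
  proof -
    have "2 * \<bar>a\<bar> * \<bar>b\<bar> \<le> \<bar>a\<bar>\<^sup>2 + \<bar>b\<bar>\<^sup>2" by (rule sum_squares_bound)
    moreover have "\<bar>a\<bar> * \<bar>b\<bar> \<ge> 0" by simp
    ultimately show ?thesis unfolding abs_mult power2_abs by linarith
  qed
  then show "AE x in M. norm (f x * g x) \<le> norm ((f x)\<^sup>2 + (g x)\<^sup>2)" by simp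
qed simp

lemma integrable_diff_L2:
  fixes f g :: "'a \<Rightarrow> real"
  assumes [measurable]: "f \<in> borel_measurable M" "g \<in> borel_measurable M"
    and "integrable M (\<lambda>x. (f x)\<^sup>2)" "integrable M (\<lambda>x. (g x)\<^sup>2)"
  shows "integrable M (\<lambda>x. (f x - g x)\<^sup>2)"
  using assms integrable_mult_L2[OF assms] by (simp add: power2_diff mult.assoc)

text \<open>Expand the integral of the nonnegative function \<open>(I f - b g)\<^sup>2\<close> with \<open>I = \<integral>g\<^sup>2\<close> and \<open>b = \<integral>f g\<close>.\<close>
lemma Cauchy_Schwarz_integral:
  fixes f g :: "'a \<Rightarrow> real"
  assumes [measurable]: "f \<in> borel_measurable M" "g \<in> borel_measurable M"
    and f: "integrable M (\<lambda>x. (f x)\<^sup>2)" and g: "integrable M (\<lambda>x. (g x)\<^sup>2)"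
    and pos: "(LINT x|M. (g x)\<^sup>2) > 0"
  shows "(LINT x|M. f x * g x)\<^sup>2 \<le> (LINT x|M. (f x)\<^sup>2) * (LINT x|M. (g x)\<^sup>2)"
proof -
  let ?I = "LINT x|M. (g x)\<^sup>2" and ?m = "LINT x|M. f x * g x" and ?s = "LINT x|M. (f x)\<^sup>2"
  note fg = integrable_mult_L2[OF assms(1-4)]
  have "0 \<le> (LINT x|M. (?I * f x - ?m * g x)\<^sup>2)" by simp
  also have "\<dots> = (LINT x|M. ?I\<^sup>2 * (f x)\<^sup>2 + ?m\<^sup>2 * (g x)\<^sup>2 - 2 * ?I * ?m * (f x * g x))"
    by (simp add: power2_diff power_mult_distrib ac_simps)
  also have "\<dots> = ?I\<^sup>2 * ?s + ?m\<^sup>2 * ?I - 2 * ?I * ?m * ?m"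
    using f g fg by simp
  also have "\<dots> = ?I * (?s * ?I - ?m\<^sup>2)"
    by (simp add: power2_eq_square algebra_simps)
  finally show ?thesis using pos by (simp add: zero_le_mult_iff)
qed

section \<open>Density of Lipschitz functions\<close>

text \<open>
  By inner regularity it suffices to treat a compact set, whose indicator is the pointwise
  limit of the Lipschitz functions \<open>max 0 (1 - n dist(x, K))\<close>.
\<close>
lemma lipschitz_approx_indicator:
  fixes M :: "'a::{complete_space, second_countable_topology} measure" and e :: real
  assumes "finite_measure M" and sets: "sets M = sets borel" and A: "A \<in> sets M" and "e > 0"
  shows "\<exists>L C. C-lipschitz_on UNIV L \<and> integrable M L \<and> (LINT x|M. \<bar>L x - indicator A x\<bar>) < e"
proof -
  interpret finite_measure M by fact
  note [measurable_cong] = sets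
  have [measurable]: "A \<in> sets borel" using A sets by simp
  have reg: "emeasure M A = (SUP K \<in> {K. K \<subseteq> A \<and> compact K}. emeasure M K)"
    by (rule inner_regular) (use sets in \<open>auto simp: emeasure_eq_measure\<close>)
  have "\<exists>K. K \<subseteq> A \<and> compact K \<and> measure M A < measure M K + e / 2"
  proof (cases "measure M A < e / 2")
    case True
    then show ?thesis by (intro exI[of _ "{}"]) auto
  next
    case False
    then have "ennreal (measure M A - e / 2) < emeasure M A"
      using \<open>e > 0\<close> by (simp add: emeasure_eq_measure ennreal_less_iff)
    then obtain K where "K \<subseteq> A" "compact K" "ennreal (measure M A - e / 2) < emeasure M K"
      unfolding reg less_SUP_iff by auto
    then show ?thesis
      using False by (intro exI[of _ K]) (auto simp: emeasure_eq_measure ennreal_less_iff)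
  qed
  then obtain K where K: "K \<subseteq> A" "compact K" "measure M A < measure M K + e / 2" by auto
  have [measurable]: "K \<in> sets borel" using K by (simp add: borel_compact)
  \<comment> \<open>The distance to the empty set is \<open>0\<close> by convention, so the approximating functions below would be \<open>1\<close>.\<close>
  show ?thesis
  proof (cases "K = {}")
    case True
    then show ?thesis using K \<open>e > 0\<close>
      by (intro exI[of _ "\<lambda>_. 0"] exI[of _ 0]) (auto simp: A lipschitz_on_constant)
  next
    case False
    define L where "L n x = max 0 (1 - real n * infdist x K)" for n :: nat and x
    have L_bound: "\<bar>L n x\<bar> \<le> 1" for n x
      by (simp add: L_def infdist_nonneg)
    have lip: "(real n)-lipschitz_on UNIV (L n)" for n
    proof (rule lipschitz_onI)
      fix x y :: 'a
      have "\<bar>L n x - L n y\<bar> \<le> \<bar>real n * infdist x K - real n * infdist y K\<bar>"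
        by (auto simp: L_def)
      also have "\<dots> = real n * \<bar>infdist x K - infdist y K\<bar>"
        by (metis abs_mult abs_of_nat right_diff_distrib)
      also have "\<dots> \<le> real n * dist x y"
        by (intro mult_left_mono infdist_triangle_abs) auto
      finally show "dist (L n x) (L n y) \<le> real n * dist x y" by (simp add: dist_real_def)
    qed simp
    have "L n \<in> borel_measurable borel" for n
      by (rule borel_measurable_continuous_onI) (rule lipschitz_on_continuous_on[OF lip])
    then have [measurable]: "L n \<in> borel_measurable M" for n by simp
    have int: "integrable M (L n)" for n
      by (rule integrable_const_bound[of _ 1]) (use L_bound in auto)
    have "(\<lambda>n. LINT x|M. \<bar>L n x - indicator K x\<bar>) \<longlonglongrightarrow> (LINT x|M. 0)"
    proof (rule integral_dominated_convergence[where w = "\<lambda>x. 2"])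
      show "AE x in M. (\<lambda>n. \<bar>L n x - indicator K x\<bar>) \<longlonglongrightarrow> 0"
      proof (rule AE_I2)
        fix x
        show "(\<lambda>n. \<bar>L n x - indicator K x\<bar>) \<longlonglongrightarrow> 0"
        proof (cases "x \<in> K")
          case True
          then show ?thesis by (simp add: L_def)
        next
          case nK: False
          then have "infdist x K > 0"
            using False K(2) by (metis compact_imp_closed in_closed_iff_infdist_zero infdist_nonneg less_eq_real_def)
          then obtain N :: nat where N: "1 < real N * infdist x K"
            using reals_Archimedean3 by blast
          have "L n x = 0" if "n \<ge> N" for n
          proof -
            have "real N * infdist x K \<le> real n * infdist x K"
              using that by (intro mult_right_mono) (auto simp: infdist_nonneg)
            then show ?thesis using N by (simp add: L_def)
          qed
          then have "eventually (\<lambda>n. \<bar>L n x - indicator K x\<bar> = 0) sequentially"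
            using nK by (auto simp: eventually_sequentially)
          then show ?thesis by (rule tendsto_eventually)
        qed
      qed
      show "AE x in M. norm \<bar>L n x - indicator K x\<bar> \<le> 2" for n
      proof (rule AE_I2)
        fix x
        show "norm \<bar>L n x - indicator K x\<bar> \<le> 2"
          using L_bound[of n x] by (auto simp: indicator_def)
      qed
    qed auto
    then have "eventually (\<lambda>n. (LINT x|M. \<bar>L n x - indicator K x\<bar>) < e / 2) sequentially"
      using \<open>e > 0\<close> by (intro order_tendstoD) auto
    then obtain n where n: "(LINT x|M. \<bar>L n x - indicator K x\<bar>) < e / 2"
      by (auto simp: eventually_sequentially)
    have ints: "integrable M (\<lambda>x. \<bar>L n x - indicator K x\<bar>)" "integrable M (indicator (A - K) :: 'a \<Rightarrow> real)"
      using int A by (auto intro!: integrable_real_indicator simp: emeasure_eq_measure)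
    have "(LINT x|M. \<bar>L n x - indicator A x\<bar>) \<le> (LINT x|M. \<bar>L n x - indicator K x\<bar> + indicator (A - K) x)"
    proof (rule integral_mono)
      show "\<bar>L n x - indicator A x\<bar> \<le> \<bar>L n x - indicator K x\<bar> + indicator (A - K) x" for x
        using K(1) by (auto simp: indicator_def)
    next
      show "integrable M (\<lambda>x. \<bar>L n x - indicator A x\<bar>)"
        "integrable M (\<lambda>x. \<bar>L n x - indicator K x\<bar> + indicator (A - K) x)"
        using int A by (auto intro!: integrable_real_indicator simp: emeasure_eq_measure)
    qed
    also have "\<dots> = (LINT x|M. \<bar>L n x - indicator K x\<bar>) + measure M (A - K)"
      using ints A by (subst Bochner_Integration.integral_add) auto
    also have "measure M (A - K) = measure M A - measure M K"
      using K(1) by (intro finite_measure_Diff) auto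
    finally show ?thesis using n K(3) lip int by (intro exI[of _ "L n"] exI[of _ "real n"]) auto
  qed
qed

lemma lipschitz_dense_L1:
  fixes M :: "'a::{complete_space, second_countable_topology} measure" and f :: "'a \<Rightarrow> real"
  assumes "finite_measure M" and sets: "sets M = sets borel" and "integrable M f" and "e > 0"
  shows "\<exists>L C. C-lipschitz_on UNIV L \<and> integrable M L \<and> (LINT x|M. \<bar>L x - f x\<bar>) < e"
  using \<open>integrable M f\<close> \<open>e > 0\<close>
proof (induction arbitrary: e)
  case (base A c)
  have "e / (\<bar>c\<bar> + 1) > 0" using \<open>e > 0\<close> by simp
  then obtain L C where L: "C-lipschitz_on UNIV L" "integrable M L"
    "(LINT x|M. \<bar>L x - indicator A x\<bar>) < e / (\<bar>c\<bar> + 1)"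
    using lipschitz_approx_indicator[OF assms(1,2) base(1)] by blast
  have "\<bar>c * L x - indicator A x *\<^sub>R c\<bar> = \<bar>c\<bar> * \<bar>L x - indicator A x\<bar>" for x
    by (cases "x \<in> A") (auto simp: right_diff_distrib simp flip: abs_mult)
  then have "(LINT x|M. \<bar>c * L x - indicator A x *\<^sub>R c\<bar>) = \<bar>c\<bar> * (LINT x|M. \<bar>L x - indicator A x\<bar>)"
    by simp
  also have "\<dots> \<le> (\<bar>c\<bar> + 1) * (LINT x|M. \<bar>L x - indicator A x\<bar>)"
    by (intro mult_right_mono) auto
  also have "\<dots> < (\<bar>c\<bar> + 1) * (e / (\<bar>c\<bar> + 1))"
    using L(3) by (intro mult_strict_left_mono) auto
  also have "\<dots> = e" by (simp add: add_nonneg_eq_0_iff)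
  finally show ?case
    using lipschitz_on_cmult_real[OF L(1)] integrable_mult_right[OF L(2)] by blast
next
  case (add f g)
  have "e / 2 > 0" using \<open>e > 0\<close> by simp
  obtain L C where L: "C-lipschitz_on UNIV L" "integrable M L" "(LINT x|M. \<bar>L x - f x\<bar>) < e / 2"
    using add.IH(1)[OF \<open>e / 2 > 0\<close>] by blast
  obtain L' C' where L': "C'-lipschitz_on UNIV L'" "integrable M L'" "(LINT x|M. \<bar>L' x - g x\<bar>) < e / 2"
    using add.IH(2)[OF \<open>e / 2 > 0\<close>] by blast
  have "(LINT x|M. \<bar>(L x + L' x) - (f x + g x)\<bar>) \<le> (LINT x|M. \<bar>L x - f x\<bar> + \<bar>L' x - g x\<bar>)"
    using L L' add.hyps by (intro integral_mono) auto
  also have "\<dots> < e" using L L' add.hyps by simp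
  finally show ?case
    using lipschitz_on_add[OF L(1) L'(1)] Bochner_Integration.integrable_add[OF L(2) L'(2)] by blast
next
  case (lim f s)
  have [measurable]: "f \<in> borel_measurable M" "\<And>i. s i \<in> borel_measurable M" using lim by auto
  have "(\<lambda>i. LINT x|M. \<bar>s i x - f x\<bar>) \<longlonglongrightarrow> (LINT x|M. 0)"
  proof (rule integral_dominated_convergence[where w = "\<lambda>x. 3 * \<bar>f x\<bar>"])
    show "AE x in M. (\<lambda>i. \<bar>s i x - f x\<bar>) \<longlonglongrightarrow> 0"
      by (intro AE_I2 tendsto_rabs_zero LIM_zero lim.hyps(2))
    show "AE x in M. norm \<bar>s i x - f x\<bar> \<le> 3 * \<bar>f x\<bar>" for i
    proof (rule AE_I2)
      fix x assume "x \<in> space M"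
      from lim.hyps(3)[OF this, of i] show "norm \<bar>s i x - f x\<bar> \<le> 3 * \<bar>f x\<bar>" by auto
    qed
  qed (use lim in auto)
  then have "eventually (\<lambda>i. (LINT x|M. \<bar>s i x - f x\<bar>) < e / 2) sequentially"
    using \<open>e > 0\<close> by (intro order_tendstoD) auto
  then obtain i where i: "(LINT x|M. \<bar>s i x - f x\<bar>) < e / 2"
    by (auto simp: eventually_sequentially)
  obtain L C where L: "C-lipschitz_on UNIV L" "integrable M L" "(LINT x|M. \<bar>L x - s i x\<bar>) < e / 2"
    using lim.IH[of "e / 2" i] half_gt_zero[OF \<open>e > 0\<close>] by blast
  have "(LINT x|M. \<bar>L x - f x\<bar>) \<le> (LINT x|M. \<bar>L x - s i x\<bar> + \<bar>s i x - f x\<bar>)"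
    using L lim by (intro integral_mono) auto
  also have "\<dots> < e" using L lim i by simp
  finally show ?case using L by blast
qed

text \<open>
  Truncating \<open>f\<close> at a high level \<open>k\<close> changes it little in \<open>L\<^sup>2\<close>. The truncated function has an
  \<open>L\<^sup>1\<close>-approximation by a Lipschitz function; truncating that one at \<open>k\<close> as well keeps it Lipschitz
  and bounds the difference by \<open>2 k\<close>, so that the squared error is at most \<open>2 k\<close> times the \<open>L\<^sup>1\<close>-error.
\<close>
lemma lipschitz_dense_L2:
  fixes M :: "'a::{complete_space, second_countable_topology} measure" and f :: "'a \<Rightarrow> real"
  assumes "finite_measure M" and sets: "sets M = sets borel"
    and [measurable]: "f \<in> borel_measurable M" and f: "integrable M (\<lambda>x. (f x)\<^sup>2)" and "e > 0"
  shows "\<exists>L C. C-lipschitz_on UNIV L \<and> integrable M (\<lambda>x. (L x)\<^sup>2) \<and> (LINT x|M. (L x - f x)\<^sup>2) < e"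
proof -
  interpret finite_measure M by fact
  define clip where "clip k t = max (- real k) (min (real k) t)" for k and t :: real
  have [measurable]: "clip k \<in> borel_measurable borel" for k
    unfolding clip_def by measurable
  have clip_bound: "\<bar>clip k t\<bar> \<le> real k" for k t by (auto simp: clip_def)
  have clip_contract: "\<bar>clip k t - clip k u\<bar> \<le> \<bar>t - u\<bar>" for k t u by (auto simp: clip_def)
  have clip_sq_int: "integrable M (\<lambda>x. (clip k (g x))\<^sup>2)" if [measurable]: "g \<in> borel_measurable M" for k and g :: "'a \<Rightarrow> real"
    by (rule integrable_const_bound[of _ "(real k)\<^sup>2"])
       (auto intro!: AE_I2 simp: abs_le_square_iff[symmetric] clip_bound)
  have "(\<lambda>k. LINT x|M. (clip k (f x) - f x)\<^sup>2) \<longlonglongrightarrow> (LINT x|M. 0)"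
  proof (rule integral_dominated_convergence[where w = "\<lambda>x. (f x)\<^sup>2"])
    show "AE x in M. (\<lambda>k. (clip k (f x) - f x)\<^sup>2) \<longlonglongrightarrow> 0"
    proof (rule AE_I2)
      fix x
      obtain N :: nat where N: "\<bar>f x\<bar> \<le> real N" using real_arch_simple by blast
      have "(clip k (f x) - f x)\<^sup>2 = 0" if "k \<ge> N" for k
        using N that by (auto simp: clip_def)
      then have "eventually (\<lambda>k. (clip k (f x) - f x)\<^sup>2 = 0) sequentially"
        unfolding eventually_sequentially by blast
      then show "(\<lambda>k. (clip k (f x) - f x)\<^sup>2) \<longlonglongrightarrow> 0" by (rule tendsto_eventually)
    qed
    show "AE x in M. norm ((clip k (f x) - f x)\<^sup>2) \<le> (f x)\<^sup>2" for k
      by (intro AE_I2) (auto simp: abs_le_square_iff[symmetric] clip_def)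
  qed (use f in auto)
  then have "eventually (\<lambda>k. (LINT x|M. (clip k (f x) - f x)\<^sup>2) < e / 4) sequentially"
    using \<open>e > 0\<close> by (intro order_tendstoD) auto
  then obtain k where k: "(LINT x|M. (clip k (f x) - f x)\<^sup>2) < e / 4"
    by (auto simp: eventually_sequentially)
  have int_clip: "integrable M (\<lambda>x. clip k (f x))"
    by (rule integrable_const_bound[of _ "real k"]) (auto simp: clip_bound)
  have "e / (8 * (real k + 1)) > 0" using \<open>e > 0\<close> by simp
  then obtain L C where L: "C-lipschitz_on UNIV L" "integrable M L"
    "(LINT x|M. \<bar>L x - clip k (f x)\<bar>) < e / (8 * (real k + 1))"
    using lipschitz_dense_L1[OF assms(1,2) int_clip] by blast
  have [measurable]: "L \<in> borel_measurable M" using L(2) by auto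
  have lip: "C-lipschitz_on UNIV (\<lambda>x. clip k (L x))"
  proof (rule lipschitz_onI)
    fix x y
    show "dist (clip k (L x)) (clip k (L y)) \<le> C * dist x y"
      using clip_contract[of k "L x" "L y"] lipschitz_onD[OF L(1), of x y] by (simp add: dist_real_def)
  qed (rule lipschitz_on_nonneg[OF L(1)])
  have "(LINT x|M. (clip k (L x) - clip k (f x))\<^sup>2) \<le> (LINT x|M. 2 * real k * \<bar>L x - clip k (f x)\<bar>)"
  proof (rule integral_mono)
    fix x
    have "clip k (clip k (f x)) = clip k (f x)" by (auto simp: clip_def)
    then have 1: "\<bar>clip k (L x) - clip k (f x)\<bar> \<le> \<bar>L x - clip k (f x)\<bar>"
      using clip_contract[of k "L x" "clip k (f x)"] by simp
    have 2: "\<bar>clip k (L x) - clip k (f x)\<bar> \<le> 2 * real k"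
      using clip_bound[of k "L x"] clip_bound[of k "f x"] by linarith
    have "(clip k (L x) - clip k (f x))\<^sup>2 = \<bar>clip k (L x) - clip k (f x)\<bar> * \<bar>clip k (L x) - clip k (f x)\<bar>"
      by (simp add: power2_eq_square)
    also have "\<dots> \<le> 2 * real k * \<bar>L x - clip k (f x)\<bar>"
      by (rule mult_mono[OF 2 1]) auto
    finally show "(clip k (L x) - clip k (f x))\<^sup>2 \<le> 2 * real k * \<bar>L x - clip k (f x)\<bar>" .
  qed (use L int_clip clip_sq_int in \<open>auto intro!: integrable_diff_L2\<close>)
  also have "\<dots> \<le> 2 * (real k + 1) * (LINT x|M. \<bar>L x - clip k (f x)\<bar>)"
    by (auto intro!: mult_right_mono)
  also have "\<dots> < e / 4"
    using L(3) by (simp add: field_simps)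
  finally have k': "(LINT x|M. (clip k (L x) - clip k (f x))\<^sup>2) < e / 4" .
  have ints: "integrable M (\<lambda>x. (clip k (L x) - clip k (f x))\<^sup>2)" "integrable M (\<lambda>x. (clip k (f x) - f x)\<^sup>2)"
     "integrable M (\<lambda>x. (clip k (L x) - f x)\<^sup>2)"
    using f clip_sq_int by (auto intro!: integrable_diff_L2)
  have "(LINT x|M. (clip k (L x) - f x)\<^sup>2)
      \<le> (LINT x|M. 2 * (clip k (L x) - clip k (f x))\<^sup>2 + 2 * (clip k (f x) - f x)\<^sup>2)"
  proof (rule integral_mono)
    fix x
    have "0 \<le> ((clip k (L x) - clip k (f x)) - (clip k (f x) - f x))\<^sup>2" by simp
    then show "(clip k (L x) - f x)\<^sup>2 \<le> 2 * (clip k (L x) - clip k (f x))\<^sup>2 + 2 * (clip k (f x) - f x)\<^sup>2"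
      by (simp add: power2_eq_square algebra_simps)
  qed (use ints in auto)
  also have "\<dots> < e" using k k' ints by simp
  finally show ?thesis
    using lip clip_sq_int[of L k] by (intro exI[of _ "\<lambda>x. clip k (L x)"] exI[of _ C]) auto
qed

lemma lipschitz_fun_borel_measurable: "lipschitz_fun L \<Longrightarrow> L \<in> borel_measurable borel"
  unfolding lipschitz_fun_def
  by (blast intro: borel_measurable_continuous_onI lipschitz_on_continuous_on)

section \<open>The conditional mean of one variable given another\<close>

text \<open>
  The hypothesis on indicators says that \<open>m(Y)\<close> is a version of \<open>E[G | Y]\<close>. Going through the
  conditional expectation extends it to every test function \<open>h\<close> for which \<open>G h(Y)\<close> is integrable,
  bounded or not.
\<close>
lemma conditional_mean_test:
  fixes G :: "'a \<Rightarrow> real" and m h :: "real \<Rightarrow> real" and Y :: "'a \<Rightarrow> real"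
  assumes "finite_measure M"
    and [measurable]: "Y \<in> borel_measurable M" "m \<in> borel_measurable borel" "h \<in> borel_measurable borel"
    and G: "integrable M G" and mY: "integrable M (\<lambda>x. m (Y x))"
    and cond: "\<And>B. B \<in> sets borel \<Longrightarrow>
       (LINT x|M. G x * indicator B (Y x)) = (LINT x|M. m (Y x) * indicator B (Y x))"
    and Gh: "integrable M (\<lambda>x. G x * h (Y x))"
  shows "(LINT x|M. G x * h (Y x)) = (LINT x|M. m (Y x) * h (Y x))"
proof -
  interpret finite_measure M by fact
  define F where "F = vimage_algebra (space M) Y (borel :: real measure)"
  have "subalgebra M F"
    unfolding subalgebra_def F_def using assms(2)
    by (auto simp: sets_vimage_algebra2 dest: measurable_sets)
  then interpret finite_measure_subalgebra M F by unfold_locales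
  have YF [measurable]: "Y \<in> measurable F borel"
    unfolding F_def by (rule measurable_vimage_algebra1) auto
  have [measurable]: "G \<in> borel_measurable M" using G by auto
  have "AE x in M. real_cond_exp M F G x = m (Y x)"
  proof (rule real_cond_exp_charact)
    fix A assume "A \<in> sets F"
    then obtain B where B: "B \<in> sets borel" "A = Y -` B \<inter> space M"
      unfolding F_def by (auto simp: sets_vimage_algebra2)
    have "(LINT x:A|M. g x) = (LINT x|M. g x * indicator B (Y x))" for g :: "_ \<Rightarrow> real"
      unfolding set_lebesgue_integral_def B(2)
      by (intro Bochner_Integration.integral_cong) (auto simp: indicator_def)
    then show "(LINT x:A|M. G x) = (LINT x:A|M. m (Y x))" using cond[OF B(1)] by simp
  qed (use G mY in auto)
  then have "(LINT x|M. h (Y x) * real_cond_exp M F G x) = (LINT x|M. h (Y x) * m (Y x))"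
    by (intro integral_cong_AE) (auto intro: borel_measurable_cond_exp2)
  moreover have "(LINT x|M. h (Y x) * real_cond_exp M F G x) = (LINT x|M. h (Y x) * G x)"
    using Gh by (intro real_cond_exp_intg) (auto simp: mult.commute)
  ultimately show ?thesis by (simp add: mult.commute)
qed

text \<open>
  The situation \<open>m(Y) = E[G | Y]\<close> with \<open>G\<close> and \<open>m(Y)\<close> square-integrable. The positive number
  \<open>E[m(Y)\<^sup>2]\<close> is the maximum of \<open>E[G h(Y)]\<^sup>2\<close> over the functions \<open>h\<close> with \<open>E[h(Y)\<^sup>2] = 1\<close>.
\<close>
locale conditional_mean = prob_space M for M :: "'a measure" +
  fixes G Y :: "'a \<Rightarrow> real" and m :: "real \<Rightarrow> real"
  assumes G_meas [measurable]: "G \<in> borel_measurable M"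
    and Y_meas [measurable]: "Y \<in> borel_measurable M"
    and m_meas [measurable]: "m \<in> borel_measurable borel"
    and G_sq: "integrable M (\<lambda>x. (G x)\<^sup>2)"
    and m_sq: "integrable M (\<lambda>x. (m (Y x))\<^sup>2)"
    and m_sq_pos: "expectation (\<lambda>x. (m (Y x))\<^sup>2) > 0"
    and cond: "\<And>B. B \<in> sets borel \<Longrightarrow>
       expectation (\<lambda>x. G x * indicator B (Y x)) = expectation (\<lambda>x. m (Y x) * indicator B (Y x))"
begin

lemma expectation_G_mult:
  assumes [measurable]: "h \<in> borel_measurable borel" and "integrable M (\<lambda>x. G x * h (Y x))"
  shows "expectation (\<lambda>x. G x * h (Y x)) = expectation (\<lambda>x. m (Y x) * h (Y x))"
  by (rule conditional_mean_test)
     (use assms cond finite_measure_axioms in \<open>auto intro: square_integrable_imp_integrable[OF _ G_sq]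
        square_integrable_imp_integrable[OF _ m_sq]\<close>)

lemma integrable_G_mult:
  assumes [measurable]: "h \<in> borel_measurable borel" and "integrable M (\<lambda>x. (h (Y x))\<^sup>2)"
  shows "integrable M (\<lambda>x. G x * h (Y x))"
  using assms G_sq by (intro integrable_mult_L2) auto

lemma expectation_G_m: "expectation (\<lambda>x. G x * m (Y x)) = expectation (\<lambda>x. (m (Y x))\<^sup>2)"
  using expectation_G_mult[OF m_meas integrable_G_mult[OF m_meas m_sq]]
  by (simp add: power2_eq_square)

lemma expectation_G_mult_sq_le:
  assumes [measurable]: "h \<in> borel_measurable borel" and h: "integrable M (\<lambda>x. (h (Y x))\<^sup>2)"
  shows "(expectation (\<lambda>x. G x * h (Y x)))\<^sup>2
    \<le> expectation (\<lambda>x. (h (Y x))\<^sup>2) * expectation (\<lambda>x. (m (Y x))\<^sup>2)"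
  using Cauchy_Schwarz_integral[of "\<lambda>x. h (Y x)" M "\<lambda>x. m (Y x)"] h m_sq m_sq_pos
    expectation_G_mult[OF _ integrable_G_mult[OF assms]]
  by (simp add: mult.commute)

text \<open>
  If \<open>L n \<longlonglongrightarrow> m\<close> in \<open>L\<^sup>2\<close> of the law of \<open>Y\<close>, both moments differ from \<open>E[m(Y)\<^sup>2]\<close> by combinations of
  \<open>d n = E[(L n(Y) - m(Y))\<^sup>2]\<close> and \<open>c n = E[(L n(Y) - m(Y)) m(Y)]\<close>, and \<open>c n\<close> vanishes with \<open>d n\<close> by
  the Cauchy-Schwarz inequality.
\<close>
lemma lipschitz_sequence:
  "\<exists>L. (\<forall>n. lipschitz_fun (L n)) \<and> (\<forall>n. integrable M (\<lambda>x. (L n (Y x))\<^sup>2)) \<and>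
    (\<lambda>n. expectation (\<lambda>x. G x * L n (Y x))) \<longlonglongrightarrow> expectation (\<lambda>x. (m (Y x))\<^sup>2) \<and>
    (\<lambda>n. expectation (\<lambda>x. (L n (Y x))\<^sup>2)) \<longlonglongrightarrow> expectation (\<lambda>x. (m (Y x))\<^sup>2)"
proof -
  let ?I = "expectation (\<lambda>x. (m (Y x))\<^sup>2)"
  let ?\<nu> = "distr M borel Y"
  have "finite_measure ?\<nu>" by (rule finite_measure_distr) simp
  moreover have "integrable ?\<nu> (\<lambda>y. (m y)\<^sup>2)"
    using m_sq by (subst integrable_distr_eq) auto
  ultimately have "\<exists>L C. C-lipschitz_on UNIV L \<and> integrable ?\<nu> (\<lambda>y. (L y)\<^sup>2) \<and>
      (LINT y|?\<nu>. (L y - m y)\<^sup>2) < inverse (real (Suc n))" for n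
    by (intro lipschitz_dense_L2) auto
  then have "\<forall>n. \<exists>L. lipschitz_fun L \<and> integrable ?\<nu> (\<lambda>y. (L y)\<^sup>2) \<and>
      (LINT y|?\<nu>. (L y - m y)\<^sup>2) < inverse (real (Suc n))"
    unfolding lipschitz_fun_def by blast
  then obtain L where L: "\<And>n. lipschitz_fun (L n)" "\<And>n. integrable ?\<nu> (\<lambda>y. (L n y)\<^sup>2)"
    "\<And>n. (LINT y|?\<nu>. (L n y - m y)\<^sup>2) < inverse (real (Suc n))"
    by metis
  have [measurable]: "L n \<in> borel_measurable borel" for n
    by (rule lipschitz_fun_borel_measurable[OF L(1)])
  have L_sq: "integrable M (\<lambda>x. (L n (Y x))\<^sup>2)" for n
    using L(2)[of n] by (subst (asm) integrable_distr_eq) auto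
  define d where "d n = expectation (\<lambda>x. (L n (Y x) - m (Y x))\<^sup>2)" for n
  define c where "c n = expectation (\<lambda>x. (L n (Y x) - m (Y x)) * m (Y x))" for n
  have diff_sq: "integrable M (\<lambda>x. (L n (Y x) - m (Y x))\<^sup>2)" for n
    using L_sq m_sq by (intro integrable_diff_L2) auto
  have diff_m: "integrable M (\<lambda>x. (L n (Y x) - m (Y x)) * m (Y x))" for n
    using diff_sq m_sq by (intro integrable_mult_L2) auto
  have "d n < inverse (real (Suc n))" for n
    using L(3)[of n] by (subst (asm) integral_distr) (auto simp: d_def)
  then have d: "d \<longlonglongrightarrow> 0"
    by (intro tendsto_sandwich[OF _ _ tendsto_const LIMSEQ_inverse_real_of_nat])
       (auto intro!: always_eventually less_imp_le simp: d_def)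
  have "\<bar>c n\<bar> \<le> sqrt (d n * ?I)" for n
    using Cauchy_Schwarz_integral[of "\<lambda>x. L n (Y x) - m (Y x)" M "\<lambda>x. m (Y x)"] diff_sq m_sq m_sq_pos
    by (intro real_le_rsqrt) (simp add: c_def d_def)
  moreover have "(\<lambda>n. sqrt (d n * ?I)) \<longlonglongrightarrow> 0"
    using tendsto_real_sqrt[OF tendsto_mult_left_zero[OF d]] by simp
  ultimately have c: "c \<longlonglongrightarrow> 0"
    by (intro Lim_null_comparison[of c]) auto
  have "expectation (\<lambda>x. G x * L n (Y x)) = c n + ?I" for n
  proof -
    have "expectation (\<lambda>x. G x * L n (Y x)) = expectation (\<lambda>x. m (Y x) * L n (Y x))"
      by (intro expectation_G_mult integrable_G_mult L_sq) auto
    also have "\<dots> = expectation (\<lambda>x. (L n (Y x) - m (Y x)) * m (Y x) + (m (Y x))\<^sup>2)"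
      by (simp add: power2_eq_square algebra_simps)
    also have "\<dots> = c n + ?I"
      unfolding c_def using diff_m m_sq by (rule Bochner_Integration.integral_add)
    finally show ?thesis .
  qed
  moreover have "expectation (\<lambda>x. (L n (Y x))\<^sup>2) = d n + 2 * c n + ?I" for n
  proof -
    have "expectation (\<lambda>x. (L n (Y x))\<^sup>2) = expectation (\<lambda>x. (L n (Y x) - m (Y x))\<^sup>2
        + 2 * ((L n (Y x) - m (Y x)) * m (Y x)) + (m (Y x))\<^sup>2)"
      by (simp add: power2_eq_square algebra_simps)
    also have "\<dots> = d n + 2 * c n + ?I"
      unfolding c_def d_def using diff_m m_sq diff_sq by simp
    finally show ?thesis .
  qed
  moreover have "(\<lambda>n. c n + ?I) \<longlonglongrightarrow> 0 + ?I"
    by (intro tendsto_intros c)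
  moreover have "(\<lambda>n. d n + 2 * c n + ?I) \<longlonglongrightarrow> 0 + 2 * 0 + ?I"
    by (intro tendsto_intros c d)
  ultimately show ?thesis
    using L(1) L_sq by (intro exI[of _ L]) simp
qed

end

section \<open>The conditional mean from the moment densities\<close>

text \<open>Over the set where \<open>f0\<close> is negative its integral is a probability, hence that set is null.\<close>
lemma moment_density_nonneg:
  assumes "moment_density P q 0 f0"
  shows "AE y in lborel. f0 y \<ge> 0"
proof -
  have f0 [measurable]: "f0 \<in> borel_measurable borel" and int: "integrable lborel f0"
    and dens: "\<And>B. B \<in> sets borel \<Longrightarrow> (LINT y:B|lborel. f0 y) = (LINT (g, e)|joint_law P. indicator B (q g e))"
    using assms unfolding moment_density_def by auto
  define A where "A = {y. f0 y < 0}"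
  have [measurable]: "A \<in> sets borel" unfolding A_def by measurable
  have "(LINT y:A|lborel. f0 y) \<ge> 0"
    by (subst dens) (auto intro!: Bochner_Integration.integral_nonneg)
  moreover have "(LINT y:A|lborel. - f0 y) \<ge> 0"
    unfolding set_lebesgue_integral_def
    by (rule Bochner_Integration.integral_nonneg) (auto simp: A_def indicator_def)
  ultimately have "(LINT y:A|lborel. - f0 y) = 0"
    by (simp add: set_lebesgue_integral_def)
  then have "A \<in> null_sets lborel"
    using int by (intro null_if_pos_func_has_zero_int[where f = "\<lambda>y. - f0 y"]) (auto simp: A_def)
  then have "AE y in lborel. y \<notin> A" by (rule AE_not_in)
  then show ?thesis by eventually_elim (auto simp: A_def)
qed

lemma prob_space_joint_law: "prob_space P \<Longrightarrow> prob_space (joint_law P)"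
  unfolding joint_law_def by (rule prob_space_pair[OF prob_space_std_gauss])

lemma distr_moment_density:
  assumes P: "prob_space P"
    and q [measurable]: "(\<lambda>x. q (fst x) (snd x)) \<in> borel_measurable (joint_law P)"
    and f0: "moment_density P q 0 f0"
  shows "distr (joint_law P) borel (\<lambda>x. q (fst x) (snd x)) = density lborel (\<lambda>y. ennreal (f0 y))"
proof (rule measure_eqI)
  interpret prob_space "joint_law P" by (rule prob_space_joint_law[OF P])
  have [measurable]: "f0 \<in> borel_measurable borel" and int: "integrable lborel f0"
    and dens: "\<And>B. B \<in> sets borel \<Longrightarrow> (LINT y:B|lborel. f0 y) = (LINT (g, e)|joint_law P. indicator B (q g e))"
    using f0 unfolding moment_density_def by auto
  fix B assume "B \<in> sets (distr (joint_law P) borel (\<lambda>x. q (fst x) (snd x)))"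
  then have [measurable]: "B \<in> sets borel" by simp
  let ?Q = "{x \<in> space (joint_law P). q (fst x) (snd x) \<in> B}"
  have "emeasure (density lborel (\<lambda>y. ennreal (f0 y))) B = (\<integral>\<^sup>+y. ennreal (indicator B y * f0 y) \<partial>lborel)"
    by (subst emeasure_density) (auto intro!: nn_integral_cong simp: indicator_def)
  also have "\<dots> = ennreal (LINT y:B|lborel. f0 y)"
    unfolding set_lebesgue_integral_def real_scaleR_def
    using integrable_mult_indicator[OF _ int, of B] moment_density_nonneg[OF f0]
    by (intro nn_integral_eq_integral) auto
  also have "(LINT y:B|lborel. f0 y) = (LINT x|joint_law P. indicator ?Q x)"
    unfolding dens[OF \<open>B \<in> sets borel\<close>] case_prod_beta'
    by (intro Bochner_Integration.integral_cong) (auto simp: indicator_def)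
  also have "\<dots> = measure (joint_law P) ?Q" by simp
  finally show "emeasure (distr (joint_law P) borel (\<lambda>x. q (fst x) (snd x))) B
      = emeasure (density lborel (\<lambda>y. ennreal (f0 y))) B"
    by (simp add: emeasure_distr emeasure_eq_measure vimage_def Int_def conj_commute)
qed simp

text \<open>
  Where \<open>f0\<close> does not vanish this is the definition of the quotient. The zero set of \<open>f0\<close> is null
  for the law of \<open>Y\<close>, so \<open>E[G 1{Y \<in> B}] = 0\<close> for each of its Borel subsets \<open>B\<close>, which forces \<open>f1 = 0\<close>
  almost everywhere there.
\<close>
lemma moment_density_eq_mult:
  assumes P: "prob_space P"
    and q [measurable]: "(\<lambda>x. q (fst x) (snd x)) \<in> borel_measurable (joint_law P)"
    and f0: "moment_density P q 0 f0" and f1: "moment_density P q 1 f1"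
  shows "AE y in lborel. f1 y = f0 y * L_star f0 f1 y"
proof -
  interpret prob_space "joint_law P" by (rule prob_space_joint_law[OF P])
  have [measurable]: "f0 \<in> borel_measurable borel"
    using f0 unfolding moment_density_def by auto
  have [measurable]: "f1 \<in> borel_measurable borel" and int: "integrable lborel f1"
    and dens: "\<And>B. B \<in> sets borel \<Longrightarrow> (LINT y:B|lborel. f1 y) = (LINT (g, e)|joint_law P. g * indicator B (q g e))"
    using f1 unfolding moment_density_def by auto
  define Z where "Z = {y. f0 y = 0}"
  have [measurable]: "Z \<in> sets borel" unfolding Z_def by measurable
  have "AE y in lborel. indicator Z y * f1 y = 0"
  proof (rule density_unique_real)
    fix A :: "real set" assume "A \<in> sets lborel"
    then have [measurable]: "A \<in> sets borel" by simp
    have "AE y in density lborel (\<lambda>y. ennreal (f0 y)). y \<notin> A \<inter> Z"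
      by (subst AE_density) (auto simp: Z_def)
    then have "AE x in joint_law P. q (fst x) (snd x) \<notin> A \<inter> Z"
      unfolding distr_moment_density[OF assms(1-3), symmetric] by (subst (asm) AE_distr_iff) auto
    then have "AE x in joint_law P. (case x of (g, e) \<Rightarrow> g * indicator (A \<inter> Z) (q g e)) = (0 :: real)"
      by eventually_elim (auto simp: indicator_def)
    then have "(LINT y:A \<inter> Z|lborel. f1 y) = 0"
      by (subst dens) (auto intro: integral_eq_zero_AE)
    then show "(LINT y:A|lborel. indicator Z y * f1 y) = (LINT y:A|lborel. 0)"
      by (simp add: set_lebesgue_integral_def indicator_inter_arith mult.assoc)
  qed (use integrable_mult_indicator[OF _ int, of Z] in auto)
  then show ?thesis
    by eventually_elim (auto simp: Z_def L_star_def indicator_def split: if_splits)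
qed

text \<open>
  Both claims are changes of variables to the density \<open>f0\<close> of \<open>Y\<close>: \<open>f0 m\<^sup>2\<close> is \<open>f1\<^sup>2 / f0\<close> on the
  support and \<open>0\<close> elsewhere, and \<open>f0 m\<close> is \<open>f1\<close>, whose integral over \<open>B\<close> is \<open>E[G 1{Y \<in> B}]\<close>.
\<close>
lemma conditional_mean_joint_law:
  assumes P: "prob_space P" "sets P = sets borel"
    and q: "(\<lambda>(g, e). q g e) \<in> borel_measurable borel"
    and f0: "moment_density P q 0 f0" and f1: "moment_density P q 1 f1"
    and int: "set_integrable lborel (dens_supp f0) (\<lambda>y. (f1 y)\<^sup>2 / f0 y)"
    and pos: "(LINT y:dens_supp f0|lborel. (f1 y)\<^sup>2 / f0 y) > 0"
  shows "conditional_mean (joint_law P) fst (\<lambda>x. q (fst x) (snd x)) (L_star f0 f1)"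
    and "(LINT x|joint_law P. (L_star f0 f1 (q (fst x) (snd x)))\<^sup>2)
      = (LINT y:dens_supp f0|lborel. (f1 y)\<^sup>2 / f0 y)"
proof -
  interpret prob_space "joint_law P" by (rule prob_space_joint_law[OF P(1)])
  interpret P: prob_space P by fact
  note [measurable_cong] = P(2)
  have sets_joint: "sets (joint_law P) = sets (borel \<Otimes>\<^sub>M borel)"
    unfolding joint_law_def by (intro sets_pair_measure_cong sets_std_gauss P(2))
  note [measurable_cong] = sets_joint
  have Y [measurable]: "(\<lambda>x. q (fst x) (snd x)) \<in> borel_measurable (joint_law P)"
    unfolding measurable_cong_sets[OF sets_joint refl]
    using q by (simp add: borel_prod case_prod_beta')
  have [measurable]: "f0 \<in> borel_measurable borel" "f1 \<in> borel_measurable borel"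
    using f0 f1 unfolding moment_density_def by auto
  let ?m = "L_star f0 f1" and ?Y = "\<lambda>x :: real \<times> real. q (fst x) (snd x)"
  have m [measurable]: "?m \<in> borel_measurable borel"
    unfolding L_star_def by measurable
  note law = distr_moment_density[OF P(1) Y f0] and nn = moment_density_nonneg[OF f0]
  have sq: "f0 y * (?m y)\<^sup>2 = indicator (dens_supp f0) y * ((f1 y)\<^sup>2 / f0 y)" for y
    by (simp add: L_star_def dens_supp_def indicator_def power2_eq_square)
  have "integrable (distr (joint_law P) borel ?Y) (\<lambda>y. (?m y)\<^sup>2)"
    unfolding law using int nn by (subst integrable_density) (auto simp: sq set_integrable_def)
  then have m_sq: "integrable (joint_law P) (\<lambda>x. (?m (?Y x))\<^sup>2)"
    by (subst (asm) integrable_distr_eq) auto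
  have "(LINT x|joint_law P. (?m (?Y x))\<^sup>2) = (LINT y|distr (joint_law P) borel ?Y. (?m y)\<^sup>2)"
    by (subst integral_distr) auto
  also have "\<dots> = (LINT y:dens_supp f0|lborel. (f1 y)\<^sup>2 / f0 y)"
    unfolding law using nn by (subst integral_density) (auto simp: sq set_lebesgue_integral_def)
  finally show m_sq_eq: "(LINT x|joint_law P. (?m (?Y x))\<^sup>2)
      = (LINT y:dens_supp f0|lborel. (f1 y)\<^sup>2 / f0 y)" .
  have G_sq: "integrable (joint_law P) (\<lambda>x. (fst x)\<^sup>2)"
    using integrable_std_gauss_power[of 2]
    by (subst (asm) P.distr_pair_fst[symmetric], subst (asm) integrable_distr_eq)
       (auto simp: joint_law_def)
  show "conditional_mean (joint_law P) fst ?Y ?m"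
  proof (unfold_locales)
    show "fst \<in> borel_measurable (joint_law P)" by measurable
    fix B :: "real set" assume B [measurable]: "B \<in> sets borel"
    have "(LINT x|joint_law P. ?m (?Y x) * indicator B (?Y x))
        = (LINT y|distr (joint_law P) borel ?Y. ?m y * indicator B y)"
      by (subst integral_distr) auto
    also have "\<dots> = (LINT y|lborel. f0 y * (?m y * indicator B y))"
      unfolding law using nn by (subst integral_density) auto
    also have "\<dots> = (LINT y:B|lborel. f1 y)"
      unfolding set_lebesgue_integral_def
    proof (rule integral_cong_AE)
      show "AE y in lborel. f0 y * (?m y * indicator B y) = indicator B y *\<^sub>R f1 y"
        using moment_density_eq_mult[OF P(1) Y f0 f1] by eventually_elim (simp add: ac_simps)
    qed auto
    also have "\<dots> = (LINT x|joint_law P. fst x * indicator B (?Y x))"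
      using f1 B unfolding moment_density_def by (auto simp: case_prod_beta')
    finally show "(LINT x|joint_law P. fst x * indicator B (?Y x))
        = (LINT x|joint_law P. ?m (?Y x) * indicator B (?Y x))" ..
  qed (use Y m m_sq m_sq_eq pos G_sq in auto)
qed

section \<open>The optimal overlap\<close>

lemma rho_lin_eq_overlap:
  assumes "integrable (joint_law P) (\<lambda>x. (L (q (fst x) (snd x)))\<^sup>2)"
  shows "rho_lin P q \<alpha> \<delta> i L = overlap (mix_weight \<alpha> i) ((mix_weight \<alpha> 1)\<^sup>2 + (mix_weight \<alpha> 2)\<^sup>2) \<delta>
    (LINT x|joint_law P. fst x * L (q (fst x) (snd x))) (LINT x|joint_law P. (L (q (fst x) (snd x)))\<^sup>2)"
proof -
  have "second_moment_L P q L = ennreal (LINT x|joint_law P. (L (q (fst x) (snd x)))\<^sup>2)"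
    unfolding second_moment_L_def case_prod_beta' using assms by (intro nn_integral_eq_integral) auto
  then show ?thesis
    by (simp add: rho_lin_def overlap_def mean_GL_def case_prod_beta')
qed

lemma second_moment_L_finite:
  assumes "(\<lambda>x. L (q (fst x) (snd x))) \<in> borel_measurable (joint_law P)"
    and "second_moment_L P q L \<noteq> \<infinity>"
  shows "integrable (joint_law P) (\<lambda>x. (L (q (fst x) (snd x)))\<^sup>2)"
  using assms unfolding second_moment_L_def case_prod_beta'
  by (intro integrableI_nonneg) (auto simp: top.not_eq_extremum)

text \<open>
  The upper bound on each overlap is \<open>overlap_le_self\<close>; it is approached along the Lipschitz
  functions of \<open>lipschitz_sequence\<close>. These belong to the class from some index on, since
  \<open>E[G L n(Y)]\<close> converges to the nonzero limit \<open>I\<close>.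
\<close>
lemma OL_lin_eq:
  fixes P :: "real measure" and q :: "real \<Rightarrow> real \<Rightarrow> real" and m :: "real \<Rightarrow> real"
  assumes "conditional_mean (joint_law P) fst (\<lambda>x. q (fst x) (snd x)) m"
    and "\<delta> > 0" and a: "mix_weight \<alpha> i > 0"
  defines "I \<equiv> LINT x|joint_law P. (m (q (fst x) (snd x)))\<^sup>2"
  shows "OL_lin P q \<alpha> \<delta> i
    = overlap (mix_weight \<alpha> i) ((mix_weight \<alpha> 1)\<^sup>2 + (mix_weight \<alpha> 2)\<^sup>2) \<delta> I I" (is "_ = ?V")
proof -
  interpret conditional_mean "joint_law P" fst "\<lambda>x. q (fst x) (snd x)" m by fact
  let ?a = "mix_weight \<alpha> i" and ?c = "(mix_weight \<alpha> 1)\<^sup>2 + (mix_weight \<alpha> 2)\<^sup>2"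
  have I: "I > 0" using m_sq_pos by (simp add: I_def)
  have c: "?c > 0"
    by (auto simp: mix_weight_def sum_power2_gt_zero_iff)
  have mean: "mean_GL P q L = expectation (\<lambda>x. fst x * L (q (fst x) (snd x)))" for L
    by (simp add: mean_GL_def case_prod_beta')
  have V: "?V \<ge> 0" using a c I \<open>\<delta> > 0\<close> by (subst overlap_self) auto
  have le: "rho_lin P q \<alpha> \<delta> i L \<le> ?V" if L: "L \<in> lin_class P q" for L
  proof (cases "second_moment_L P q L = \<infinity>")
    case True
    then show ?thesis using V by (simp add: rho_lin_def)
  next
    case False
    have Lm [measurable]: "L \<in> borel_measurable borel"
      using L by (auto simp: lin_class_def intro: lipschitz_fun_borel_measurable)
    have sq: "integrable (joint_law P) (\<lambda>x. (L (q (fst x) (snd x)))\<^sup>2)"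
      by (rule second_moment_L_finite[OF _ False]) measurable
    show ?thesis
      unfolding rho_lin_eq_overlap[where L = L and q = q, OF sq]
      using L expectation_G_mult_sq_le[OF Lm sq]
      by (intro overlap_le_self a c I \<open>\<delta> > 0\<close>) (auto simp: lin_class_def mean I_def)
  qed
  obtain L where L: "\<And>n. lipschitz_fun (L n)" "\<And>n. integrable (joint_law P) (\<lambda>x. (L n (q (fst x) (snd x)))\<^sup>2)"
    "(\<lambda>n. expectation (\<lambda>x. fst x * L n (q (fst x) (snd x)))) \<longlonglongrightarrow> I"
    "(\<lambda>n. expectation (\<lambda>x. (L n (q (fst x) (snd x)))\<^sup>2)) \<longlonglongrightarrow> I"
    using lipschitz_sequence unfolding I_def by blast
  have lim: "(\<lambda>n. rho_lin P q \<alpha> \<delta> i (L n)) \<longlonglongrightarrow> ?V"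
    unfolding rho_lin_eq_overlap[where L = "L n" and q = q for n, OF L(2)]
    by (intro tendsto_overlap c I \<open>\<delta> > 0\<close> L)
  have ev: "eventually (\<lambda>n. L n \<in> lin_class P q) sequentially"
    using order_tendstoD(1)[OF L(3) I]
  proof eventually_elim
    case (elim n)
    have "integrable (joint_law P) (\<lambda>x. fst x * L n (q (fst x) (snd x)))"
      by (intro integrable_G_mult lipschitz_fun_borel_measurable L)
    then show ?case
      using elim L(1) by (auto simp: lin_class_def mean GL_integrable_def case_prod_beta')
  qed
  then have ne: "lin_class P q \<noteq> {}"
    by (auto simp: eventually_sequentially)
  have bdd: "bdd_above (rho_lin P q \<alpha> \<delta> i ` lin_class P q)"
    using le by (auto intro!: bdd_aboveI)
  have "(SUP L\<in>lin_class P q. rho_lin P q \<alpha> \<delta> i L) \<le> ?V"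
    by (rule cSUP_least[OF ne le])
  moreover have "?V \<le> (SUP L\<in>lin_class P q. rho_lin P q \<alpha> \<delta> i L)"
    using lim
  proof (rule tendsto_upperbound)
    show "eventually (\<lambda>n. rho_lin P q \<alpha> \<delta> i (L n) \<le> (SUP L\<in>lin_class P q. rho_lin P q \<alpha> \<delta> i L)) sequentially"
      using ev by eventually_elim (rule cSUP_upper[OF _ bdd])
  qed simp
  ultimately show ?thesis using ne by (simp add: OL_lin_def)
qed

theorem proposition3p10:
  fixes P :: "real measure" and q :: "real \<Rightarrow> real \<Rightarrow> real" and \<alpha> :: real
    and f0 f1 :: "real \<Rightarrow> real"
  assumes "prob_space P" and "sets P = sets borel"
    and "integrable P (\<lambda>e. e\<^sup>2)"
    and "(\<lambda>(g, e). q g e) \<in> borel_measurable borel"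
    and "1/2 < \<alpha>" and "\<alpha> < 1"
    and "moment_density P q 0 f0"
    and "moment_density P q 1 f1"
    and "set_integrable lborel (dens_supp f0) (\<lambda>y. (f1 y)\<^sup>2 / f0 y)"
    and "(LINT y:dens_supp f0|lborel. (f1 y)\<^sup>2 / f0 y) > 0"
  shows
    "(\<forall>\<delta>>0. \<forall>i\<in>{1, 2}. OL_lin P q \<alpha> \<delta> i =
        (((mix_weight \<alpha> 1)\<^sup>2 + (mix_weight \<alpha> 2)\<^sup>2) / (mix_weight \<alpha> i)\<^sup>2
         + 1 / ((mix_weight \<alpha> i)\<^sup>2 * \<delta>)
           * (1 / (LINT y:dens_supp f0|lborel. (f1 y)\<^sup>2 / f0 y))) powr (-1/2))
     \<and> mean_GL P q (L_star f0 f1) \<noteq> 0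
     \<and> GL_integrable P q (L_star f0 f1)
     \<and> (lipschitz_fun (L_star f0 f1) \<longrightarrow> L_star f0 f1 \<in> lin_class P q)
     \<and> (\<forall>\<delta>>0. \<forall>i\<in>{1, 2}. rho_lin P q \<alpha> \<delta> i (L_star f0 f1) = OL_lin P q \<alpha> \<delta> i)
     \<and> (\<forall>L. lipschitz_fun L \<and> (AE y in lborel. y \<in> dens_supp f0 \<longrightarrow> L y = L_star f0 f1 y) \<longrightarrow>
          L \<in> lin_class P q \<and>
          (\<forall>\<delta>>0. \<forall>i\<in>{1, 2}. rho_lin P q \<alpha> \<delta> i L = OL_lin P q \<alpha> \<delta> i))"
proof -
  let ?Y = "\<lambda>x :: real \<times> real. q (fst x) (snd x)" and ?m = "L_star f0 f1"
  let ?c = "(mix_weight \<alpha> 1)\<^sup>2 + (mix_weight \<alpha> 2)\<^sup>2"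
  define I where "I = (LINT y:dens_supp f0|lborel. (f1 y)\<^sup>2 / f0 y)"
  note model = conditional_mean_joint_law[OF assms(1,2,4,7-10)]
  interpret conditional_mean "joint_law P" fst ?Y ?m by (rule model(1))
  have I: "I > 0" "expectation (\<lambda>x. (?m (?Y x))\<^sup>2) = I"
    using assms(10) model(2) by (auto simp: I_def)
  have a: "mix_weight \<alpha> i > 0" for i
    using assms(5,6) by (simp add: mix_weight_def)
  have c: "?c > 0"
    by (intro add_pos_pos zero_less_power a)
  have OL: "OL_lin P q \<alpha> \<delta> i = overlap (mix_weight \<alpha> i) ?c \<delta> I I" if "\<delta> > 0" for \<delta> i
    using OL_lin_eq[OF model(1) that a] I(2) by simp
  \<comment> \<open>Neither moment of \<open>L(Y)\<close> sees a change of \<open>L\<close> on a null set of the law of \<open>Y\<close>, so all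
     versions of the optimal function can be treated together.\<close>
  have version: "mean_GL P q L \<noteq> 0" "GL_integrable P q L"
    "\<And>\<delta> i. \<delta> > 0 \<Longrightarrow> rho_lin P q \<alpha> \<delta> i L = OL_lin P q \<alpha> \<delta> i"
    if [measurable]: "L \<in> borel_measurable borel"
      and eq: "AE y in lborel. y \<in> dens_supp f0 \<longrightarrow> L y = ?m y" for L
  proof -
    have "AE y in density lborel (\<lambda>y. ennreal (f0 y)). L y = ?m y"
      using assms(7) eq unfolding moment_density_def
      by (subst AE_density) (auto elim!: eventually_mono simp: dens_supp_def)
    then have eqY: "AE x in joint_law P. L (?Y x) = ?m (?Y x)"
      unfolding distr_moment_density[OF assms(1) Y_meas assms(7), symmetric]
      by (subst (asm) AE_distr_iff) auto
    have sq: "integrable (joint_law P) (\<lambda>x. (L (?Y x))\<^sup>2)"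
      using m_sq by (rule integrable_cong_AE_imp) (use eqY in auto)
    have sq_eq: "expectation (\<lambda>x. (L (?Y x))\<^sup>2) = I"
      unfolding I(2)[symmetric] by (rule integral_cong_AE) (use eqY in auto)
    have mean: "expectation (\<lambda>x. fst x * L (?Y x)) = I"
      unfolding I(2)[symmetric] expectation_G_m[symmetric] by (rule integral_cong_AE) (use eqY in auto)
    show "mean_GL P q L \<noteq> 0"
      using mean I(1) by (simp add: mean_GL_def case_prod_beta')
    show "GL_integrable P q L"
      using integrable_G_mult[OF _ sq] by (simp add: GL_integrable_def case_prod_beta')
    show "rho_lin P q \<alpha> \<delta> i L = OL_lin P q \<alpha> \<delta> i" if "\<delta> > 0" for \<delta> i
      unfolding rho_lin_eq_overlap[where L = L and q = q, OF sq] OL[OF that] mean sq_eq ..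
  qed
  have star: "mean_GL P q ?m \<noteq> 0" "GL_integrable P q ?m"
    "\<And>\<delta> i. \<delta> > 0 \<Longrightarrow> rho_lin P q \<alpha> \<delta> i ?m = OL_lin P q \<alpha> \<delta> i"
    using version[OF m_meas] by auto
  have "OL_lin P q \<alpha> \<delta> i = (?c / (mix_weight \<alpha> i)\<^sup>2
      + 1 / ((mix_weight \<alpha> i)\<^sup>2 * \<delta>) * (1 / I)) powr (-1/2)" if "\<delta> > 0" for \<delta> i
    unfolding OL[OF that] by (rule overlap_self_powr[OF a c that I(1)])
  then show ?thesis
    using star version lipschitz_fun_borel_measurable unfolding I_def[symmetric]
    by (auto simp: lin_class_def)
qed

end
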